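(* For every $n\ge 1$, the dimension of $P_{\mathrm{HTSASM}}$ is $\left\lceil\frac{(n-1)^2}{2}\right\rceil$.
   Context: An $n\times n$ alternating sign matrix (ASM) is an $n\times n$ matrix with entries in $\{0,1,-1\}$ such that in each row and each column the non-zero entries alternate in sign and the first and last non-zero entries are $1$ (so every row and column sums to $1$). An HTSASM (half-turn symmetric ASM) is an $n\times n$ ASM $X$ with $x_{i,j}=x_{n+1-i,n+1-j}$ for all $i,j\in\{1,\dots,n\}$. $P_{\mathrm{HTSASM}}\subseteq\mathbb R^{n\times n}$ is the convex hull of all $n\times n$ HTSASMs. The dimension of a polytope is the dimension of its affine hull. *)

theory Defs
  imports "HOL-Analysis.Analysis"
begin

text \<open>
  Entries are indexed by natural numbers \<open>1, \<dots>, n\<close>; values outside this range are irrelevant.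
\<close>

definition alternating_line :: "nat \<Rightarrow> (nat \<Rightarrow> real) \<Rightarrow> bool" where
  "alternating_line n v \<longleftrightarrow>
     (\<forall>i\<in>{1..n}. v i \<in> {0, 1, -1}) \<and>
     (\<forall>i\<in>{1..n}. \<forall>j\<in>{1..n}. i < j \<and> v i \<noteq> 0 \<and> v j \<noteq> 0 \<and> (\<forall>k\<in>{i<..<j}. v k = 0)
        \<longrightarrow> v j = - v i) \<and>
     (\<exists>i\<in>{1..n}. v i = 1 \<and> (\<forall>k\<in>{1..<i}. v k = 0)) \<and>
     (\<exists>i\<in>{1..n}. v i = 1 \<and> (\<forall>k\<in>{i<..n}. v k = 0))"

definition is_ASM :: "nat \<Rightarrow> (nat \<Rightarrow> nat \<Rightarrow> real) \<Rightarrow> bool" where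
  "is_ASM n x \<longleftrightarrow>
     (\<forall>i\<in>{1..n}. alternating_line n (\<lambda>j. x i j)) \<and>
     (\<forall>j\<in>{1..n}. alternating_line n (\<lambda>i. x i j))"

definition is_HTSASM :: "nat \<Rightarrow> (nat \<Rightarrow> nat \<Rightarrow> real) \<Rightarrow> bool" where
  "is_HTSASM n x \<longleftrightarrow>
     is_ASM n x \<and> (\<forall>i\<in>{1..n}. \<forall>j\<in>{1..n}. x i j = x (n + 1 - i) (n + 1 - j))"

text \<open>
  The space of real \<open>n \<times> n\<close> matrices is \<open>real ^ 'n ^ 'n\<close>, where an enumeration \<open>e\<close>, a bijection
  from \<open>{1..n}\<close> onto the index type \<open>'n\<close>, numbers the rows and columns: the \<open>(i, j)\<close> entry
  of \<open>X\<close> is \<open>X $ e i $ e j\<close>.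
\<close>

definition P_HTSASM :: "nat \<Rightarrow> (nat \<Rightarrow> 'n::finite) \<Rightarrow> (real ^ 'n ^ 'n) set" where
  "P_HTSASM n e = convex hull {X. is_HTSASM n (\<lambda>i j. X $ e i $ e j)}"

end

theory Submission
  imports Defs
begin

text \<open>
  Half-turn symmetric matrices with zero row and column sums have a basis of symmetrised
  \<open>2 \<times> 2\<close> blocks \<open>block n i j\<close>, one for each orbit of \<open>(i, j) \<mapsto> (n - i, n - j)\<close> on
  \<open>{1..<n} \<times> {1..<n}\<close>, because the corner sums of the blocks are the indicators of these orbits.
  Differences of HTSASMs lie in this space. Conversely, every block is, up to a factor, a
  difference of two HTSASMs. Take the least HTSASM corner sum function exceeding the minimum
  at \<open>(i, j)\<close>. It can be lowered by one at \<open>(i, j)\<close> and \<open>(n - i, n - j)\<close> simultaneously: these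
  points are never adjacent, since \<open>n - 2 * i\<close> and \<open>n - 2 * j\<close> have the same parity.
\<close>

section \<open>Alternating lines and their partial sums\<close>

text \<open>Partial sums are 0 before the first non-zero entry; afterwards they are 1 or 0 according
  to the sign of the latest non-zero entry. The last non-zero entry is 1.\<close>

lemma alternating_line_sum:
  assumes "alternating_line n v"
  shows "(\<Sum>k=1..n. v k) = 1"
proof -
  have vals: "v k \<in> {0, 1, -1}" if "k \<in> {1..n}" for k
    using assms that by (auto simp: alternating_line_def)
  have alt: "v j = - v i"
    if "i \<in> {1..n}" "j \<in> {1..n}" "i < j" "v i \<noteq> 0" "v j \<noteq> 0" "\<forall>k\<in>{i<..<j}. v k = 0" for i j
    using assms that unfolding alternating_line_def by blast
  obtain f where f: "f \<in> {1..n}" "v f = 1" "\<forall>k\<in>{1..<f}. v k = 0"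
    using assms by (auto simp: alternating_line_def)
  obtain l where l: "l \<in> {1..n}" "v l = 1" "\<forall>k\<in>{l<..n}. v k = 0"
    using assms by (auto simp: alternating_line_def)
  have inv: "(\<forall>i\<in>{1..k}. v i = 0) \<and> (\<Sum>i=1..k. v i) = 0 \<or>
     (\<exists>m\<in>{1..k}. v m \<noteq> 0 \<and> (\<forall>i\<in>{m<..k}. v i = 0) \<and> (\<Sum>i=1..k. v i) = of_bool (v m = 1))"
    if "k \<le> n" for k
    using that
  proof (induction k)
    case 0
    then show ?case by simp
  next
    case (Suc k)
    have S: "(\<Sum>i=1..Suc k. v i) = (\<Sum>i=1..k. v i) + v (Suc k)" by simp
    show ?case
    proof (cases "v (Suc k) = 0")
      case True
      show ?thesis
        using Suc
      proof (elim meta_impE disjE)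
        assume "\<exists>m\<in>{1..k}. v m \<noteq> 0 \<and> (\<forall>i\<in>{m<..k}. v i = 0) \<and> (\<Sum>i=1..k. v i) = of_bool (v m = 1)"
        then obtain m where m: "m \<in> {1..k}" "v m \<noteq> 0" "\<forall>i\<in>{m<..k}. v i = 0"
          "(\<Sum>i=1..k. v i) = of_bool (v m = 1)" by blast
        show ?thesis
          using m True S by (intro disjI2 bexI[of _ m]) (auto simp: le_Suc_eq)
      qed (use True S in \<open>auto simp: le_Suc_eq\<close>)
    next
      case False
      have "(\<Sum>i=1..Suc k. v i) = of_bool (v (Suc k) = 1)"
        using Suc
      proof (elim meta_impE disjE)
        assume z: "(\<forall>i\<in>{1..k}. v i = 0) \<and> (\<Sum>i=1..k. v i) = 0"
        then have "\<not> f \<le> k" using f by auto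
        moreover have "\<not> Suc k < f" using f(3) False by auto
        ultimately have "f = Suc k" by simp
        then show ?thesis using z f S by simp
      next
        assume "\<exists>m\<in>{1..k}. v m \<noteq> 0 \<and> (\<forall>i\<in>{m<..k}. v i = 0) \<and> (\<Sum>i=1..k. v i) = of_bool (v m = 1)"
        then obtain m where m: "m \<in> {1..k}" "v m \<noteq> 0" "\<forall>i\<in>{m<..k}. v i = 0"
          "(\<Sum>i=1..k. v i) = of_bool (v m = 1)" by blast
        have "v (Suc k) = - v m"
          using m False Suc.prems by (intro alt) auto
        moreover have "v m = 1 \<or> v m = -1" using vals[of m] m Suc.prems by auto
        ultimately show ?thesis using m S by auto
      qed simp
      then show ?thesis using False by (intro disjI2 bexI[of _ "Suc k"]) auto
    qed
  qed
  from inv[of n] show ?thesis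
  proof (elim meta_impE disjE)
    assume "(\<forall>i\<in>{1..n}. v i = 0) \<and> (\<Sum>i=1..n. v i) = 0"
    then show ?thesis using f by simp
  next
    assume "\<exists>m\<in>{1..n}. v m \<noteq> 0 \<and> (\<forall>i\<in>{m<..n}. v i = 0) \<and> (\<Sum>i=1..n. v i) = of_bool (v m = 1)"
    then obtain m where m: "m \<in> {1..n}" "v m \<noteq> 0" "\<forall>i\<in>{m<..n}. v i = 0"
      "(\<Sum>i=1..n. v i) = of_bool (v m = 1)" by blast
    have "m = l" using m l by (metis atLeastAtMost_iff greaterThanAtMost_iff linorder_neqE_nat zero_neq_one)
    then show ?thesis using m l by simp
  qed simp
qed

text \<open>The non-zero increments of a walk in {0, 1} are alternately up and down steps. Starting
  at 0 forces the first to be up, ending at 1 forces the last to be up.\<close>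

lemma alternating_line_of_partial_sums:
  fixes s :: "nat \<Rightarrow> int"
  assumes "s 0 = 0" "s n = 1" and s01: "\<And>k. k \<le> n \<Longrightarrow> s k \<in> {0, 1}"
    and v: "\<And>k. k \<in> {1..n} \<Longrightarrow> v k = real_of_int (s k - s (k - 1))"
  shows "alternating_line n v"
proof -
  \<comment> \<open>Zero entries leave \<open>s\<close> unchanged, so the next non-zero step starts
    where the previous one ended and must go the opposite way.\<close>
  have const: "s (j - 1) = s i" if "i < j" "j \<le> Suc n" "\<forall>k\<in>{i<..<j}. v k = 0" for i j
    using that
  proof (induction j)
    case (Suc j)
    show ?case
    proof (cases "i = j")
      case False
      then have "j \<in> {i<..<Suc j}" "j \<in> {1..n}" using Suc.prems by auto
      then have "s j = s (j - 1)" using Suc.prems(3) v[of j] by auto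
      then show ?thesis using Suc False by auto
    qed simp
  qed simp
  have c1: "v i \<in> {0, 1, -1}" if "i \<in> {1..n}" for i
    using s01[of i] s01[of "i - 1"] v[OF that] that by (cases i) auto
  have c2: "v j = - v i" if "i \<in> {1..n}" "j \<in> {1..n}" "i < j" "v i \<noteq> 0" "v j \<noteq> 0"
    "\<forall>k\<in>{i<..<j}. v k = 0" for i j
    using const[of i j] s01[of i] s01[of "i - 1"] s01[of j] v[of i] v[of j] that by auto
  define f where "f = (LEAST k. s k = 1)"
  have sf: "s f = 1" and fmin: "k < f \<Longrightarrow> s k \<noteq> 1" for k
    unfolding f_def using assms(2) by (rule LeastI) (rule not_less_Least)
  have fn: "f \<le> n" using fmin[of n] assms(2) by force
  have f0: "1 \<le> f" using sf assms(1) by (cases f) auto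
  have fz: "s k = 0" if "k < f" for k using fmin[OF that] s01[of k] that fn by auto
  have c3: "\<exists>i\<in>{1..n}. v i = 1 \<and> (\<forall>k\<in>{1..<i}. v k = 0)"
    using f0 fn sf fz v by (intro bexI[of _ f]) auto
  \<comment> \<open>After its last zero \<open>g\<close> the walk stays at 1, so the last non-zero
    entry sits at \<open>Suc g\<close>.\<close>
  define g where "g = (GREATEST k. k \<le> n \<and> s k = 0)"
  have g: "g \<le> n \<and> s g = 0"
    unfolding g_def by (rule GreatestI_nat[where k = 0 and b = n]) (use assms(1) in auto)
  have gmax: "k \<le> g" if "k \<le> n" "s k = 0" for k
    unfolding g_def by (rule Greatest_le_nat[where b = n]) (use that in auto)
  have gn: "g < n" using g assms(2) by (metis le_neq_implies_less zero_neq_one)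
  have g1: "s k = 1" if "g < k" "k \<le> n" for k using gmax[of k] s01[of k] that by auto
  have c4: "\<exists>i\<in>{1..n}. v i = 1 \<and> (\<forall>k\<in>{i<..n}. v k = 0)"
  proof (intro bexI[of _ "Suc g"] conjI ballI)
    show "v (Suc g) = 1" using v[of "Suc g"] g1[of "Suc g"] g gn by simp
    show "v k = 0" if k: "k \<in> {Suc g<..n}" for k
      using v[of k] g1[of k] g1[of "k - 1"] k by force
  qed (use gn in simp)
  show ?thesis unfolding alternating_line_def using c1 c2 c3 c4 by blast
qed

section \<open>Corner sum functions of HTSASMs\<close>

text \<open>Characterises the corner sums \<open>C a b = (\<Sum>i=1..a. \<Sum>j=1..b. x i j)\<close> of HTSASMs \<open>x\<close>.\<close>

definition ht_corner :: "nat \<Rightarrow> (nat \<Rightarrow> nat \<Rightarrow> int) \<Rightarrow> bool" where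
  "ht_corner n C \<longleftrightarrow>
     (\<forall>b\<le>n. C 0 b = 0 \<and> C n b = int b) \<and>
     (\<forall>a\<le>n. C a 0 = 0 \<and> C a n = int a) \<and>
     (\<forall>a<n. \<forall>b\<le>n. C (Suc a) b - C a b \<in> {0, 1}) \<and>
     (\<forall>a\<le>n. \<forall>b<n. C a (Suc b) - C a b \<in> {0, 1}) \<and>
     (\<forall>a\<le>n. \<forall>b\<le>n. C (n - a) (n - b) = C a b + int n - int a - int b)"

text \<open>The mixed second difference recovers a matrix from its corner sums. It has this meaning
  only for \<open>a\<close>, \<open>b\<close> \<ge> 1, since subtraction on \<open>nat\<close>
  truncates.\<close>

definition corner_diff :: "(nat \<Rightarrow> nat \<Rightarrow> int) \<Rightarrow> nat \<Rightarrow> nat \<Rightarrow> real" where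
  "corner_diff C a b = real_of_int (C a b - C (a - 1) b - C a (b - 1) + C (a - 1) (b - 1))"

text \<open>Partial sums along a row or column telescope to increments of \<open>C\<close>, which
  lie in {0, 1}. The affine terms of the rotation rule cancel in the mixed difference, which leaves
  half-turn symmetry.\<close>

lemma corner_diff_HTSASM:
  assumes "ht_corner n C"
  shows "is_HTSASM n (corner_diff C)"
proof -
  have bd: "C 0 b = 0" "C n b = int b" "C b 0 = 0" "C b n = int b" if "b \<le> n" for b
    using assms that by (auto simp: ht_corner_def)
  have st1: "C (Suc a) b - C a b \<in> {0, 1}" if "a < n" "b \<le> n" for a b
    using assms that by (auto simp: ht_corner_def)
  have st2: "C a (Suc b) - C a b \<in> {0, 1}" if "a \<le> n" "b < n" for a b
    using assms that by (auto simp: ht_corner_def)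
  have rot: "C (n - a) (n - b) = C a b + int n - int a - int b" if "a \<le> n" "b \<le> n" for a b
    using assms that by (auto simp: ht_corner_def)
  have "alternating_line n (\<lambda>b. corner_diff C a b)" if "a \<in> {1..n}" for a
  proof (rule alternating_line_of_partial_sums[where s = "\<lambda>b. C a b - C (a - 1) b"])
    show "C a k - C (a - 1) k \<in> {0, 1}" if "k \<le> n" for k
      using st1[of "a - 1" k] \<open>a \<in> {1..n}\<close> that by (cases a) auto
  qed (use that in \<open>auto simp: bd corner_diff_def of_nat_diff\<close>)
  moreover have "alternating_line n (\<lambda>a. corner_diff C a b)" if "b \<in> {1..n}" for b
  proof (rule alternating_line_of_partial_sums[where s = "\<lambda>a. C a b - C a (b - 1)"])
    show "C k b - C k (b - 1) \<in> {0, 1}" if "k \<le> n" for k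
      using st2[of k "b - 1"] \<open>b \<in> {1..n}\<close> that by (cases b) auto
  qed (use that in \<open>auto simp: bd corner_diff_def of_nat_diff\<close>)
  moreover have "corner_diff C a b = corner_diff C (n + 1 - a) (n + 1 - b)"
    if dom: "a \<in> {1..n}" "b \<in> {1..n}" for a b
  proof -
    obtain a' b' where ab: "a = Suc a'" "b = Suc b'" "a' < n" "b' < n"
      using dom by (cases a; cases b) auto
    have eq: "n + 1 - a = n - a'" "n + 1 - b = n - b'" "n - a' - 1 = n - a" "n - b' - 1 = n - b"
      "a - 1 = a'" "b - 1 = b'"
      using ab by auto
    show ?thesis
      unfolding corner_diff_def eq using dom ab(3,4) by (simp add: rot ab(1,2))
  qed
  ultimately show ?thesis by (simp add: is_HTSASM_def is_ASM_def)
qed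

text \<open>Around (i, j) the increments are 1 on the way in and 0 on the way out, so lowering the
  value there only swaps 0 and 1. The same holds at the rotated point, and the two changes never
  meet in one increment.\<close>

lemma ht_corner_flip:
  assumes C: "ht_corner n C" and ij: "i \<in> {1..<n}" "j \<in> {1..<n}"
    and up: "C (Suc i) j = C i j" "C i (Suc j) = C i j"
    and down: "C (i - 1) j = C i j - 1" "C i (j - 1) = C i j - 1"
  shows "ht_corner n (\<lambda>a b. C a b - of_bool ((a, b) \<in> {(i, j), (n - i, n - j)}))"
proof -
  have bd: "C 0 b = 0" "C n b = int b" "C b 0 = 0" "C b n = int b" if "b \<le> n" for b
    using C that by (auto simp: ht_corner_def)
  have st1: "C (Suc a) b - C a b \<in> {0, 1}" if "a < n" "b \<le> n" for a b
    using C that by (auto simp: ht_corner_def)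
  have st2: "C a (Suc b) - C a b \<in> {0, 1}" if "a \<le> n" "b < n" for a b
    using C that by (auto simp: ht_corner_def)
  have rot: "C (n - a) (n - b) = C a b + int n - int a - int b" if "a \<le> n" "b \<le> n" for a b
    using C that by (auto simp: ht_corner_def)
  define P where "P = {(i, j), (n - i, n - j)}"
  have eq: "n - i - 1 = n - Suc i" "n - j - 1 = n - Suc j" "Suc (n - i) = n - (i - 1)"
    "Suc (n - j) = n - (j - 1)"
    using ij by auto
  \<comment> \<open>The half turn exchanges the roles of \<open>up\<close> and \<open>down\<close>,
    so the rotated point satisfies the same four conditions.\<close>
  define c where "c = C i j + int n - int i - int j"
  have rots: "C (n - i) (n - j) = c" "C (Suc (n - i)) (n - j) = c" "C (n - i) (Suc (n - j)) = c"
    "C (n - i - 1) (n - j) = c - 1" "C (n - i) (n - j - 1) = c - 1"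
    unfolding eq c_def
    using ij up down rot[of i j] rot[of "Suc i" j] rot[of i "Suc j"] rot[of "i - 1" j]
      rot[of i "j - 1"] by (simp_all add: of_nat_diff)
  have up': "C (Suc a) b = C a b" "C a (Suc b) = C a b"
    and down': "C (a - 1) b = C a b - 1" "C a (b - 1) = C a b - 1" if ab: "(a, b) \<in> P" for a b
  proof -
    consider "a = i" "b = j" | "a = n - i" "b = n - j" using ab by (auto simp: P_def)
    then show "C (Suc a) b = C a b" "C a (Suc b) = C a b"
      "C (a - 1) b = C a b - 1" "C a (b - 1) = C a b - 1"
      by (cases; simp only: up down rots)+
  qed
  \<comment> \<open>Adjacent points would have one coordinate fixed by \<open>n - k = k\<close>, so
    \<open>n\<close> is even, and the other shifted by one, so \<open>n\<close> is odd.\<close>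
  have ev: "even n" if "n - k = k" "k < n" for k
  proof -
    have "n = 2 * k" using that by simp
    then show ?thesis by simp
  qed
  have od: "odd n" if "n - k = Suc k \<or> k = Suc (n - k)" "k < n" for k
  proof -
    have "n = 2 * k + 1 \<or> n + 1 = 2 * k" using that by linarith
    then show ?thesis by (metis dvd_triv_left even_plus_one_iff)
  qed
  have par: "n - i = Suc i \<Longrightarrow> n - j \<noteq> j" "n - j = Suc j \<Longrightarrow> n - i \<noteq> i"
    "i = Suc (n - i) \<Longrightarrow> n - j \<noteq> j" "j = Suc (n - j) \<Longrightarrow> n - i \<noteq> i"
    using ev[of i] ev[of j] od[of i] od[of j] ij by auto
  have nadj: "\<not> ((a, b) \<in> P \<and> (Suc a, b) \<in> P)" "\<not> ((a, b) \<in> P \<and> (a, Suc b) \<in> P)" for a b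
    unfolding P_def insert_iff empty_iff prod.inject using par n_not_Suc_n by metis+
  \<comment> \<open>Here \<open>p\<close> and \<open>q\<close> say that the lower and the upper end
    of the increment are lowered: the first turns 0 into 1, the second turns 1 into 0.\<close>
  have step: "y - of_bool q - (x - of_bool p) \<in> {0, 1}"
    if h: "y - x \<in> {0, 1}" "p \<Longrightarrow> y = x" "q \<Longrightarrow> x = y - 1" "\<not> (p \<and> q)" for x y :: int and p q
  proof -
    consider "p" "\<not> q" "y = x" | "\<not> p" "q" "x = y - 1" | "\<not> p" "\<not> q" using h by blast
    then show ?thesis using h(1) by cases auto
  qed
  have "C (Suc a) b - of_bool ((Suc a, b) \<in> P) - (C a b - of_bool ((a, b) \<in> P)) \<in> {0, 1}"
    if "a < n" "b \<le> n" for a b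
    by (rule step[OF st1[OF that] up'(1) down'(1)[of "Suc a" b, unfolded diff_Suc_1] nadj(1)])
  moreover have "C a (Suc b) - of_bool ((a, Suc b) \<in> P) - (C a b - of_bool ((a, b) \<in> P)) \<in> {0, 1}"
    if "a \<le> n" "b < n" for a b
    by (rule step[OF st2[OF that] up'(2) down'(2)[of a "Suc b", unfolded diff_Suc_1] nadj(2)])
  moreover have "((n - a, n - b) \<in> P) = ((a, b) \<in> P)" if "a \<le> n" "b \<le> n" for a b
  proof -
    have "n - k = l \<longleftrightarrow> k = n - l" "n - k = n - l \<longleftrightarrow> k = l" if "k \<le> n" "l < n" for k l
      using that by linarith+
    then show ?thesis using that ij by (auto simp: P_def)
  qed
  moreover have "(0, b) \<notin> P" "(n, b) \<notin> P" "(b, 0) \<notin> P" "(b, n) \<notin> P" for b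
    using ij by (auto simp: P_def)
  ultimately show ?thesis
    unfolding ht_corner_def P_def[symmetric] by (simp add: bd rot)
qed

section \<open>A corner sum function that can be lowered at a given orbit\<close>

text \<open>These are the corner sums of the antidiagonal permutation matrix, the pointwise least
  ones on {0..n} \<times> {0..n}.\<close>

definition corner_min :: "nat \<Rightarrow> nat \<Rightarrow> nat \<Rightarrow> int" where
  "corner_min n a b = max 0 (int a + int b - int n)"

text \<open>The least function with increments in \<open>{0, 1}\<close> whose value at \<open>(i, j)\<close> exceeds
  \<open>corner_min n i j\<close> by one.\<close>

definition corner_peak :: "nat \<Rightarrow> nat \<Rightarrow> nat \<Rightarrow> nat \<Rightarrow> nat \<Rightarrow> int" where
  "corner_peak n i j a b =
     corner_min n i j + 1 - max 0 (int i - int a) - max 0 (int j - int b)"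

text \<open>The second peak, at the rotated point, makes the maximum compatible with the half
  turn.\<close>

definition corner_join :: "nat \<Rightarrow> nat \<Rightarrow> nat \<Rightarrow> nat \<Rightarrow> nat \<Rightarrow> int" where
  "corner_join n i j a b =
     max (corner_min n a b) (max (corner_peak n i j a b) (corner_peak n (n - i) (n - j) a b))"

text \<open>A pointwise maximum keeps increments in {0, 1}. The half turn preserves
  \<open>corner_min\<close> and exchanges the two peaks, and on the boundary no peak exceeds
  \<open>corner_min\<close>.\<close>

lemma ht_corner_join:
  assumes ij: "i \<in> {1..<n}" "j \<in> {1..<n}"
  shows "ht_corner n (corner_join n i j)"
proof -
  have max_step: "max x y - max x' y' \<in> {0, 1}" if "x - x' \<in> {0, 1}" "y - y' \<in> {0, 1}"
    for x x' y y' :: int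
    using that by auto
  have m1: "corner_min n (Suc a) b - corner_min n a b \<in> {0, 1}"
    and m2: "corner_min n a (Suc b) - corner_min n a b \<in> {0, 1}" for a b
    by (auto simp: corner_min_def)
  have p1: "corner_peak n i j (Suc a) b - corner_peak n i j a b \<in> {0, 1}"
    and p2: "corner_peak n i j a (Suc b) - corner_peak n i j a b \<in> {0, 1}" for a b i j
    by (auto simp: corner_peak_def)
  \<comment> \<open>For interior (i, j) the value \<open>corner_min n i j\<close> is strictly below
    both \<open>i\<close> and \<open>j\<close>, which leaves room for the extra 1.\<close>
  have pb: "corner_peak n i j 0 b \<le> 0" "corner_peak n i j n b \<le> int b"
    "corner_peak n i j b 0 \<le> 0" "corner_peak n i j b n \<le> int b"
    if "i \<in> {1..<n}" "j \<in> {1..<n}" for b i j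
    using that by (auto simp: corner_peak_def corner_min_def)
  have ij': "n - i \<in> {1..<n}" "n - j \<in> {1..<n}" using ij by auto
  \<comment> \<open>Both rotation rules come from the identity
    \<open>max 0 (- t) = max 0 t - t\<close>.\<close>
  have mr: "corner_min n (n - a) (n - b) = corner_min n a b + int n - int a - int b"
    if "a \<le> n" "b \<le> n" for a b
    using that by (auto simp: corner_min_def of_nat_diff)
  have pr: "corner_peak n (n - i) (n - j) (n - a) (n - b) = corner_peak n i j a b + int n - int a - int b"
    if "a \<le> n" "b \<le> n" "i \<le> n" "j \<le> n" for a b i j
    using that by (auto simp: corner_peak_def corner_min_def of_nat_diff)
  have "corner_join n i j 0 b = 0" "corner_join n i j n b = int b"
     "corner_join n i j b 0 = 0" "corner_join n i j b n = int b" if "b \<le> n" for b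
    unfolding corner_join_def using pb[OF ij, of b] pb[OF ij', of b] that
    by (auto simp: corner_min_def)
  moreover have "corner_join n i j (Suc a) b - corner_join n i j a b \<in> {0, 1}"
    "corner_join n i j a (Suc b) - corner_join n i j a b \<in> {0, 1}" for a b
    unfolding corner_join_def by (intro max_step m1 m2 p1 p2)+
  moreover have "corner_join n i j (n - a) (n - b) = corner_join n i j a b + int n - int a - int b"
    if "a \<le> n" "b \<le> n" for a b
  proof -
    have "corner_peak n i j (n - a) (n - b) =
        corner_peak n (n - i) (n - j) a b + int n - int a - int b"
      using pr[of a b "n - i" "n - j"] that ij by simp
    moreover have "max (x + c - d - e) (max (y + c - d - e) (z + c - d - e)) =
        max x (max z y) + c - d - e" for x y z c d e :: int
      by linarith
    moreover have "i \<le> n" "j \<le> n" using ij by auto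
    ultimately show ?thesis unfolding corner_join_def by (simp only: pr mr that)
  qed
  ultimately show ?thesis unfolding ht_corner_def by simp
qed

text \<open>At (i, j) and its four neighbours the maximum equals the peak belonging to (i, j), which
  is flat beyond that point and has slope 1 before it.\<close>

lemma corner_join_flippable:
  assumes ij: "i \<in> {1..<n}" "j \<in> {1..<n}"
  shows "corner_join n i j (Suc i) j = corner_join n i j i j"
    "corner_join n i j i (Suc j) = corner_join n i j i j"
    "corner_join n i j (i - 1) j = corner_join n i j i j - 1"
    "corner_join n i j i (j - 1) = corner_join n i j i j - 1"
proof -
  define P where "P = corner_peak n i j"
  define Q where "Q = corner_peak n (n - i) (n - j)"
  define M where "M = corner_min n"
  have m: "M (Suc i) j \<le> M i j + 1" "M i (Suc j) \<le> M i j + 1" "M (i - 1) j \<le> M i j"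
    "M i (j - 1) \<le> M i j"
    unfolding M_def by (auto simp: corner_min_def)
  have p: "P i j = M i j + 1" "P (Suc i) j = M i j + 1" "P i (Suc j) = M i j + 1"
    "P (i - 1) j = M i j" "P i (j - 1) = M i j"
    unfolding M_def P_def using ij by (auto simp: corner_peak_def of_nat_diff)
  have q: "Q i j \<le> M i j" "Q (Suc i) j \<le> Q i j + 1" "Q i (Suc j) \<le> Q i j + 1"
     "Q (i - 1) j \<le> Q i j" "Q i (j - 1) \<le> Q i j" if "(n - i, n - j) \<noteq> (i, j)"
  proof -
    \<comment> \<open>With u = n - 2i and v = n - 2j, the difference \<open>Q i j - M i j\<close> is
      1 - (abs u + abs v) / 2. As u and v have equal parity and are not both 0, abs u + abs v is at
      least 2.\<close>
    show "Q i j \<le> M i j"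
    unfolding Q_def M_def using ij that
      by (auto simp: corner_peak_def corner_min_def of_nat_diff; presburger)
  qed (auto simp: Q_def corner_peak_def)
  have eqQP: "Q = P" if "(n - i, n - j) = (i, j)" using that by (simp add: P_def Q_def)
  have Qle: "Q i j \<le> M i j + 1 \<and> Q (Suc i) j \<le> M i j + 1 \<and> Q i (Suc j) \<le> M i j + 1 \<and>
      Q (i - 1) j \<le> M i j \<and> Q i (j - 1) \<le> M i j"
  proof (cases "(n - i, n - j) = (i, j)")
    case True
    then show ?thesis using eqQP p by simp
  next
    case False
    show ?thesis using q[OF False] by (auto intro: order_trans)
  qed
  have mx: "max x (max y z) = y" if "x \<le> y" "z \<le> y" for x y z :: int
    using that by simp
  have J: "corner_join n i j a b = max (M a b) (max (P a b) (Q a b))" for a b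
    by (simp add: corner_join_def M_def P_def Q_def)
  have "corner_join n i j i j = M i j + 1" "corner_join n i j (Suc i) j = M i j + 1"
    "corner_join n i j i (Suc j) = M i j + 1"
    "corner_join n i j (i - 1) j = M i j" "corner_join n i j i (j - 1) = M i j"
    unfolding J p by (rule mx; use m Qle in simp)+
  then show "corner_join n i j (Suc i) j = corner_join n i j i j"
    "corner_join n i j i (Suc j) = corner_join n i j i j"
    "corner_join n i j (i - 1) j = corner_join n i j i j - 1"
    "corner_join n i j i (j - 1) = corner_join n i j i j - 1"
    by simp_all
qed

lemma ht_corner_min: "ht_corner n (corner_min n)"
  by (auto simp: ht_corner_def corner_min_def of_nat_diff)

section \<open>Symmetrised blocks and expansion by corner sums\<close>

text \<open>The product \<open>bump i a * bump j b\<close> is the 2 \<times> 2 block with entries 1,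
  -1, -1, 1 and top left corner (i, j).\<close>

definition bump :: "nat \<Rightarrow> nat \<Rightarrow> real" where
  "bump i a = of_bool (a = i) - of_bool (a = Suc i)"

text \<open>Twice a single \<open>2 \<times> 2\<close> block when \<open>(i, j)\<close> is the centre \<open>(n/2, n/2)\<close>.\<close>

definition block :: "nat \<Rightarrow> nat \<Rightarrow> nat \<Rightarrow> nat \<Rightarrow> nat \<Rightarrow> real" where
  "block n i j a b = bump i a * bump j b + bump (n - i) a * bump (n - j) b"

text \<open>The orbit point with the smaller first coordinate is chosen, ties being broken by the
  second. The non-strict inequality keeps the fixed centre.\<close>

definition orbit_reps :: "nat \<Rightarrow> (nat \<times> nat) set" where
  "orbit_reps n = {(i, j) \<in> {1..<n} \<times> {1..<n}. i < n - i \<or> i = n - i \<and> j \<le> n - j}"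

lemma sum_bump:
  assumes "1 \<le> i"
  shows "(\<Sum>a=1..k. bump i a) = of_bool (k = i)"
  using assms by (induction k) (auto simp: bump_def)

text \<open>Only \<open>i = a\<close> and \<open>i = a - 1\<close> contribute; the zeros of
  \<open>f\<close> at 0 and \<open>n\<close> stand in for the terms outside the range of
  summation.\<close>

lemma sum_times_bump:
  assumes "f 0 = 0" "f n = 0" "a \<in> {1..n}"
  shows "(\<Sum>i=1..<n. f i * bump i a) = f a - f (a - 1)"
proof -
  have "(\<Sum>i=1..<n. f i * bump i a) = (\<Sum>i\<in>{1..<n}. if i = a then f i else 0) -
      (\<Sum>i\<in>{1..<n}. if i = a - 1 then f i else 0)"
    unfolding sum_subtractf[symmetric] using assms(3) by (intro sum.cong) (auto simp: bump_def)
  also have "\<dots> = f a - f (a - 1)"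
    using assms by (cases "a = n"; cases "a = 1") (auto simp: sum.delta)
  finally show ?thesis .
qed

text \<open>Zero row and column sums make the corner sums vanish on the boundary, so
  \<open>sum_times_bump\<close> applies first in the column index and then in the row index.\<close>

lemma sum_corner_bump:
  fixes x :: "nat \<Rightarrow> nat \<Rightarrow> real"
  assumes rows: "\<And>a. a \<in> {1..n} \<Longrightarrow> (\<Sum>b=1..n. x a b) = 0"
    and cols: "\<And>b. b \<in> {1..n} \<Longrightarrow> (\<Sum>a=1..n. x a b) = 0"
    and ab: "a \<in> {1..n}" "b \<in> {1..n}"
  shows "(\<Sum>i=1..<n. \<Sum>j=1..<n. (\<Sum>k=1..i. \<Sum>l=1..j. x k l) * (bump i a * bump j b)) = x a b"
proof -
  have last: "sum f {1..c} - sum f {1..c - 1} = f c" if "c \<in> {1..n}" for f :: "nat \<Rightarrow> real" and c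
    using that by (cases c) auto
  have inner: "(\<Sum>j=1..<n. (\<Sum>k=1..i. \<Sum>l=1..j. x k l) * bump j b) = (\<Sum>k=1..i. x k b)"
    if "i \<in> {1..<n}" for i
  proof -
    have "(\<Sum>j=1..<n. (\<Sum>k=1..i. \<Sum>l=1..j. x k l) * bump j b) =
        (\<Sum>k=1..i. \<Sum>l=1..b. x k l) - (\<Sum>k=1..i. \<Sum>l=1..b - 1. x k l)"
      using that ab(2) rows by (intro sum_times_bump) auto
    also have "\<dots> = (\<Sum>k=1..i. x k b)"
      unfolding sum_subtractf[symmetric] using last[OF ab(2)] by simp
    finally show ?thesis .
  qed
  have "(\<Sum>i=1..<n. \<Sum>j=1..<n. (\<Sum>k=1..i. \<Sum>l=1..j. x k l) * (bump i a * bump j b)) =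
     (\<Sum>i=1..<n. (\<Sum>j=1..<n. (\<Sum>k=1..i. \<Sum>l=1..j. x k l) * bump j b) * bump i a)"
    by (intro sum.cong refl) (subst sum_distrib_right, simp only: mult_ac)
  also have "\<dots> = (\<Sum>i=1..<n. (\<Sum>k=1..i. x k b) * bump i a)"
    using inner by (intro sum.cong) auto
  also have "\<dots> = (\<Sum>k=1..a. x k b) - (\<Sum>k=1..a - 1. x k b)"
    using ab cols by (intro sum_times_bump) auto
  also have "\<dots> = x a b"
    by (rule last[OF ab(1)])
  finally show ?thesis .
qed

text \<open>Reflection swaps the entries 1 and -1. In a product of two bumps the signs cancel, so
  the second summand of \<open>block\<close> is the half turn of the first.\<close>

lemma bump_reflect:
  assumes "i \<in> {1..<n}" "a \<in> {1..n}"
  shows "bump (n - i) a = - bump i (n + 1 - a)"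
proof -
  have "a = n - i \<longleftrightarrow> n + 1 - a = Suc i" "a = Suc (n - i) \<longleftrightarrow> n + 1 - a = i"
    using assms by auto
  then show ?thesis by (simp add: bump_def)
qed

text \<open>The two summands of \<open>block\<close> reproduce \<open>x\<close> at (a, b) and at the
  rotated position, where symmetry gives the same value; hence the factor 2.\<close>

lemma sum_corner_block:
  fixes x :: "nat \<Rightarrow> nat \<Rightarrow> real"
  assumes rows: "\<And>a. a \<in> {1..n} \<Longrightarrow> (\<Sum>b=1..n. x a b) = 0"
    and cols: "\<And>b. b \<in> {1..n} \<Longrightarrow> (\<Sum>a=1..n. x a b) = 0"
    and sym: "\<And>a b. a \<in> {1..n} \<Longrightarrow> b \<in> {1..n} \<Longrightarrow> x (n + 1 - a) (n + 1 - b) = x a b"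
    and ab: "a \<in> {1..n}" "b \<in> {1..n}"
  shows "(\<Sum>i=1..<n. \<Sum>j=1..<n. (\<Sum>k=1..i. \<Sum>l=1..j. x k l) * block n i j a b) = 2 * x a b"
proof -
  let ?c = "\<lambda>i j. \<Sum>k=1..i. \<Sum>l=1..j. x k l"
  have "(\<Sum>i=1..<n. \<Sum>j=1..<n. ?c i j * block n i j a b) =
      (\<Sum>i=1..<n. \<Sum>j=1..<n. ?c i j * (bump i a * bump j b) +
        ?c i j * (bump i (n + 1 - a) * bump j (n + 1 - b)))"
    using ab by (intro sum.cong refl) (simp add: block_def bump_reflect distrib_left)
  also have "\<dots> = x a b + x (n + 1 - a) (n + 1 - b)"
    unfolding sum.distrib using ab
    by (intro arg_cong2[where f = "(+)"] sum_corner_bump rows cols) auto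
  finally show ?thesis using sym[OF ab] by simp
qed

text \<open>Corner sums of a product factor into partial sums of bumps. At the centre both
  indicators refer to the same point and the value is 2.\<close>

lemma corner_sum_block:
  assumes "i \<in> {1..<n}" "j \<in> {1..<n}"
  shows "(\<Sum>a=1..k. \<Sum>b=1..l. block n i j a b) =
    of_bool ((k, l) = (i, j)) + of_bool ((k, l) = (n - i, n - j))"
proof -
  have "(\<Sum>a=1..k. \<Sum>b=1..l. block n i j a b) =
     (\<Sum>a=1..k. bump i a) * (\<Sum>b=1..l. bump j b) + (\<Sum>a=1..k. bump (n - i) a) * (\<Sum>b=1..l. bump (n - j) b)"
    by (simp add: block_def sum.distrib sum_product)
  also have "\<dots> = of_bool (k = i) * of_bool (l = j) + of_bool (k = n - i) * of_bool (l = n - j)"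
    using assms by (subst (1 2 3 4) sum_bump) auto
  finally show ?thesis by simp
qed

section \<open>Counting the orbits\<close>

text \<open>The representatives and their reflections cover the grid and overlap at most in the
  centre, which is a grid point exactly for even \<open>n\<close>.\<close>

lemma card_orbit_reps:
  assumes "n \<ge> 1"
  shows "2 * card (orbit_reps n) = (n - 1)\<^sup>2 + of_bool (even n)"
proof -
  let ?A = "{1..<n} \<times> {1..<n}" and ?r = "\<lambda>(i, j). (n - i, n - j)"
  have fin: "finite (orbit_reps n)"
    by (rule finite_subset[of _ ?A]) (auto simp: orbit_reps_def)
  have sub: "i < n \<and> j < n \<and> 1 \<le> i \<and> 1 \<le> j" if "(i, j) \<in> orbit_reps n" for i j
    using that by (auto simp: orbit_reps_def)
  have inj: "inj_on ?r (orbit_reps n)"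
    using sub by (fastforce simp: inj_on_def)
  have mem: "p \<in> ?r ` orbit_reps n \<longleftrightarrow> p \<in> ?A \<and> ?r p \<in> orbit_reps n" for p
  proof
    assume "p \<in> ?r ` orbit_reps n"
    then show "p \<in> ?A \<and> ?r p \<in> orbit_reps n" using sub by (fastforce simp: orbit_reps_def)
  next
    assume "p \<in> ?A \<and> ?r p \<in> orbit_reps n"
    then show "p \<in> ?r ` orbit_reps n"
      by (intro image_eqI[of _ _ "?r p"]) auto
  qed
  have un: "orbit_reps n \<union> ?r ` orbit_reps n = ?A"
    unfolding set_eq_iff Un_iff mem by (auto simp: orbit_reps_def)
  have int: "orbit_reps n \<inter> ?r ` orbit_reps n = (if even n \<and> n \<ge> 2 then {(n div 2, n div 2)} else {})"
  proof -
    have half: "k = n - k \<longleftrightarrow> even n \<and> k = n div 2" if "k < n" for k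
    proof -
      have "k = n - k \<longleftrightarrow> n = 2 * k" using that by linarith
      then show ?thesis by auto
    qed
    \<comment> \<open>By the choice of representatives, a point and its reflection are both chosen
      only if they coincide.\<close>
    have "p \<in> orbit_reps n \<and> p \<in> ?A \<and> ?r p \<in> orbit_reps n \<longleftrightarrow>
        p \<in> ?A \<and> fst p = n - fst p \<and> snd p = n - snd p" for p
      by (cases p) (auto simp: orbit_reps_def)
    also have "\<dots> p \<longleftrightarrow> p \<in> ?A \<and> even n \<and> p = (n div 2, n div 2)" for p
      using half by (cases p) auto
    finally have "p \<in> orbit_reps n \<inter> ?r ` orbit_reps n \<longleftrightarrow>
        p \<in> ?A \<and> even n \<and> p = (n div 2, n div 2)" for p
      unfolding Int_iff mem .
    then have "orbit_reps n \<inter> ?r ` orbit_reps n = {p \<in> ?A. even n \<and> p = (n div 2, n div 2)}"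
      by (intro set_eqI) (simp only: mem_Collect_eq)
    also have "\<dots> = (if even n \<and> n \<ge> 2 then {(n div 2, n div 2)} else {})" by auto
    finally show ?thesis .
  qed
  have "2 * card (orbit_reps n) = card (orbit_reps n) + card (?r ` orbit_reps n)"
    using card_image[OF inj] by simp
  also have "\<dots> = card ?A + card (orbit_reps n \<inter> ?r ` orbit_reps n)"
    unfolding un[symmetric] by (rule card_Un_Int) (use fin in auto)
  also have "\<dots> = (n - 1)\<^sup>2 + of_bool (even n)"
    unfolding int using assms by (auto simp: power2_eq_square)
  finally show ?thesis .
qed

text \<open>The number of orbits exceeds half the square by 0 or 1/2, so it is the ceiling.\<close>

lemma ceiling_half_square:
  assumes "n \<ge> 1"
  shows "\<lceil>(real n - 1)\<^sup>2 / 2\<rceil> = int (card (orbit_reps n))"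
proof -
  have "2 * real (card (orbit_reps n)) = real ((n - 1)\<^sup>2 + of_bool (even n))"
    using card_orbit_reps[OF assms] by (metis of_nat_mult of_nat_numeral)
  also have "\<dots> = (real n - 1)\<^sup>2 + of_bool (even n)"
    using assms by (simp add: of_nat_diff)
  finally show ?thesis by (cases "even n") (intro ceiling_unique; simp)+
qed

section \<open>Transfer to matrices over the index type\<close>

definition mat_of :: "nat \<Rightarrow> (nat \<Rightarrow> 'n::finite) \<Rightarrow> (nat \<Rightarrow> nat \<Rightarrow> real) \<Rightarrow> real ^ 'n ^ 'n" where
  "mat_of n e f = (\<chi> r s. f (inv_into {1..n} e r) (inv_into {1..n} e s))"

lemma mat_of_nth:
  assumes "bij_betw e {1..n} (UNIV :: 'n::finite set)" "a \<in> {1..n}" "b \<in> {1..n}"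
  shows "mat_of n e f $ e a $ e b = f a b"
  using assms by (simp add: mat_of_def bij_betw_inv_into_left[OF assms(1)] del: One_nat_def)

lemma matrix_eqI:
  fixes X Y :: "real ^ 'n ^ 'n"
  assumes e: "bij_betw e {1..n} (UNIV :: 'n::finite set)"
    and eq: "\<And>a b. a \<in> {1..n} \<Longrightarrow> b \<in> {1..n} \<Longrightarrow> X $ e a $ e b = Y $ e a $ e b"
  shows "X = Y"
proof -
  have "X $ r $ s = Y $ r $ s" for r s
  proof -
    have "r \<in> e ` {1..n}" "s \<in> e ` {1..n}" using e by (auto simp: bij_betw_def)
    then show ?thesis using eq by auto
  qed
  then show ?thesis by (simp add: vec_eq_iff)
qed

text \<open>\<open>mat_of\<close> reproduces a function only on indices in {1..n}; this transfers
  the property in spite of that.\<close>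

lemma HTSASM_cong:
  assumes "\<And>a b. a \<in> {1..n} \<Longrightarrow> b \<in> {1..n} \<Longrightarrow> x a b = y a b" "is_HTSASM n y"
  shows "is_HTSASM n x"
proof -
  have line: "alternating_line n u \<longleftrightarrow> alternating_line n v"
    if "\<And>k. k \<in> {1..n} \<Longrightarrow> u k = v k" for u v
    unfolding alternating_line_def using that by (intro arg_cong2[where f = "(\<and>)"] ball_cong bex_cong refl) auto
  have "alternating_line n (x i) = alternating_line n (y i)" if "i \<in> {1..n}" for i
    using assms(1) that by (intro line) auto
  moreover have "alternating_line n (\<lambda>i. x i j) = alternating_line n (\<lambda>i. y i j)"
    if "j \<in> {1..n}" for j
    using assms(1) that by (intro line) auto
  moreover have "x i j = x (n + 1 - i) (n + 1 - j)" if ij: "i \<in> {1..n}" "j \<in> {1..n}" for i j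
  proof -
    have "n + 1 - i \<in> {1..n}" "n + 1 - j \<in> {1..n}" using ij by auto
    then show ?thesis using assms ij unfolding is_HTSASM_def by metis
  qed
  ultimately show ?thesis
    using assms(2) unfolding is_HTSASM_def is_ASM_def by metis
qed

lemma HTSASM_mat_of_corner_diff:
  assumes "bij_betw e {1..n} (UNIV :: 'n::finite set)" "ht_corner n C"
  shows "is_HTSASM n (\<lambda>i j. mat_of n e (corner_diff C) $ e i $ e j)"
  by (rule HTSASM_cong[OF _ corner_diff_HTSASM[OF assms(2)]]) (simp add: mat_of_nth[OF assms(1)])

section \<open>The blocks as a basis of the space of differences\<close>

text \<open>Lowering \<open>corner_join\<close> at the orbit of (i, j) changes the matrix by a
  multiple of the block. The base point \<open>X0\<close> is arbitrary because it cancels.\<close>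

lemma block_in_span_differences:
  fixes e :: "nat \<Rightarrow> 'n::finite"
  assumes e: "bij_betw e {1..n} (UNIV :: 'n set)" and ij: "i \<in> {1..<n}" "j \<in> {1..<n}"
  shows "mat_of n e (block n i j) \<in>
    span ((\<lambda>X. X - X0) ` {X. is_HTSASM n (\<lambda>a b. X $ e a $ e b)})"
proof -
  let ?S = "{X. is_HTSASM n (\<lambda>a b. X $ e a $ e b)}"
  let ?P = "{(i, j), (n - i, n - j)}"
  define C where "C = corner_join n i j"
  define C' where "C' = (\<lambda>a b. C a b - of_bool ((a, b) \<in> ?P))"
  have C: "ht_corner n C" unfolding C_def by (rule ht_corner_join[OF ij])
  have "ht_corner n C'"
    unfolding C'_def using ij C corner_join_flippable[OF ij, folded C_def] by (intro ht_corner_flip)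
  then have S: "mat_of n e (corner_diff C) \<in> ?S" "mat_of n e (corner_diff C') \<in> ?S"
    using HTSASM_mat_of_corner_diff[OF e] C by auto
  \<comment> \<open>At the centre the two points of \<open>?P\<close> coincide: \<open>C\<close> is
    lowered once there, while \<open>block\<close> counts the point twice.\<close>
  define d :: real where "d = (if (n - i, n - j) = (i, j) then 2 else 1)"
  have delta: "of_bool (p \<in> ?P) = (of_bool (p = (i, j)) + of_bool (p = (n - i, n - j))) / d" for p
    by (auto simp: d_def)
  have dbump: "of_bool ((a, b) = (k, l)) - of_bool ((a - 1, b) = (k, l)) - of_bool ((a, b - 1) = (k, l))
      + of_bool ((a - 1, b - 1) = (k, l)) = bump k a * bump l b"
    if "a \<ge> 1" "b \<ge> 1" "k \<ge> 1" "l \<ge> 1" for a b k l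
  proof -
    have "a - 1 = k \<longleftrightarrow> a = Suc k" "b - 1 = l \<longleftrightarrow> b = Suc l" using that by auto
    then show ?thesis by (auto simp: bump_def)
  qed
  have entry: "corner_diff C a b - corner_diff C' a b = block n i j a b / d"
    if ab: "a \<ge> 1" "b \<ge> 1" for a b
  proof -
    have bumps: "bump i a * bump j b = of_bool ((a, b) = (i, j)) - of_bool ((a - 1, b) = (i, j)) -
          of_bool ((a, b - 1) = (i, j)) + of_bool ((a - 1, b - 1) = (i, j))"
      "bump (n - i) a * bump (n - j) b = of_bool ((a, b) = (n - i, n - j)) -
          of_bool ((a - 1, b) = (n - i, n - j)) - of_bool ((a, b - 1) = (n - i, n - j)) +
          of_bool ((a - 1, b - 1) = (n - i, n - j))"
      by (rule dbump[symmetric]; use ab ij in auto)+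
    have regroup: "(u1 + v1) / d - (u2 + v2) / d - (u3 + v3) / d + (u4 + v4) / d =
        ((u1 - u2 - u3 + u4) + (v1 - v2 - v3 + v4)) / d" for u1 u2 u3 u4 v1 v2 v3 v4
      by (simp add: add_divide_distrib diff_divide_distrib)
    have "corner_diff C a b - corner_diff C' a b = of_bool ((a, b) \<in> ?P) - of_bool ((a - 1, b) \<in> ?P)
        - of_bool ((a, b - 1) \<in> ?P) + of_bool ((a - 1, b - 1) \<in> ?P)"
      by (simp only: corner_diff_def C'_def of_int_diff of_int_add of_int_of_bool algebra_simps)
    also have "\<dots> = block n i j a b / d"
      unfolding delta block_def bumps by (rule regroup)
    finally show ?thesis .
  qed
  have "mat_of n e (block n i j) = d *\<^sub>R
     ((mat_of n e (corner_diff C) - X0) - (mat_of n e (corner_diff C') - X0))"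
    by (rule matrix_eqI[OF e]) (simp add: mat_of_nth[OF e] entry, simp add: d_def)
  also have "\<dots> \<in> span ((\<lambda>X. X - X0) ` ?S)"
    using S by (intro span_scale span_diff span_base imageI)
  finally show ?thesis .
qed

text \<open>All lines of both matrices sum to 1, so the difference has zero line sums and is
  half-turn symmetric, as \<open>sum_corner_block\<close> requires.\<close>

lemma HTSASM_difference_in_span:
  fixes X Y :: "real ^ 'n ^ 'n"
  assumes e: "bij_betw e {1..n} (UNIV :: 'n::finite set)"
    and XY: "is_HTSASM n (\<lambda>a b. X $ e a $ e b)" "is_HTSASM n (\<lambda>a b. Y $ e a $ e b)"
  shows "X - Y \<in> span ((\<lambda>(i, j). mat_of n e (block n i j)) ` orbit_reps n)"
proof -
  let ?B = "(\<lambda>(i, j). mat_of n e (block n i j)) ` orbit_reps n"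
  define x where "x = (\<lambda>a b. X $ e a $ e b - Y $ e a $ e b)"
  have rows: "(\<Sum>b=1..n. x a b) = 0" if "a \<in> {1..n}" for a
  proof -
    have "alternating_line n (\<lambda>c. X $ e a $ e c)" "alternating_line n (\<lambda>c. Y $ e a $ e c)"
      using XY that by (simp_all add: is_HTSASM_def is_ASM_def)
    then show ?thesis unfolding x_def sum_subtractf using alternating_line_sum by fastforce
  qed
  have cols: "(\<Sum>a=1..n. x a b) = 0" if "b \<in> {1..n}" for b
  proof -
    have "alternating_line n (\<lambda>c. X $ e c $ e b)" "alternating_line n (\<lambda>c. Y $ e c $ e b)"
      using XY that by (simp_all add: is_HTSASM_def is_ASM_def)
    then show ?thesis unfolding x_def sum_subtractf using alternating_line_sum by fastforce
  qed
  have sym: "x (n + 1 - a) (n + 1 - b) = x a b" if "a \<in> {1..n}" "b \<in> {1..n}" for a b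
    using XY that unfolding x_def is_HTSASM_def by metis
  \<comment> \<open>The expansion runs over the whole grid; a block at a position that is not a
    representative equals the block at the reflected position.\<close>
  have block_in: "mat_of n e (block n i j) \<in> span ?B" if "i \<in> {1..<n}" "j \<in> {1..<n}" for i j
  proof (cases "(i, j) \<in> orbit_reps n")
    case False
    then have "(n - i, n - j) \<in> orbit_reps n" using that by (auto simp: orbit_reps_def)
    moreover have "block n i j = block n (n - i) (n - j)"
      using that by (intro ext) (simp add: block_def add.commute)
    ultimately show ?thesis by (intro span_base) force
  qed (auto intro: span_base)
  have "X - Y = (1 / 2) *\<^sub>R (\<Sum>i=1..<n. \<Sum>j=1..<n. (\<Sum>k=1..i. \<Sum>l=1..j. x k l) *\<^sub>R mat_of n e (block n i j))"
  proof (rule matrix_eqI[OF e])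
    fix a b assume ab: "a \<in> {1..n}" "b \<in> {1..n}"
    show "(X - Y) $ e a $ e b = ((1 / 2) *\<^sub>R (\<Sum>i=1..<n. \<Sum>j=1..<n.
        (\<Sum>k=1..i. \<Sum>l=1..j. x k l) *\<^sub>R mat_of n e (block n i j))) $ e a $ e b"
      using sum_corner_block[OF rows cols sym ab]
      by (simp add: mat_of_nth[OF e ab] x_def del: One_nat_def)
  qed
  also have "\<dots> \<in> span ?B"
    by (intro span_scale span_sum block_in)
  finally show ?thesis .
qed

text \<open>The corner sums at the representatives are linear functionals dual to the blocks, up to
  a factor 2 at the centre.\<close>

lemma independent_blocks:
  fixes e :: "nat \<Rightarrow> 'n::finite"
  assumes e: "bij_betw e {1..n} (UNIV :: 'n set)"
  defines "D \<equiv> (\<lambda>(i, j). mat_of n e (block n i j))"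
  shows "independent (D ` orbit_reps n)" "inj_on D (orbit_reps n)"
proof -
  define \<phi> where "\<phi> = (\<lambda>(k, l) (X :: real ^ 'n ^ 'n). \<Sum>a=1..k. \<Sum>b=1..l. X $ e a $ e b)"
  have lin: "linear (\<phi> q)" for q
    unfolding \<phi>_def
    by (cases q) (auto intro!: linearI simp: sum.distrib sum_distrib_left)
  have \<phi>: "\<phi> q (D p) = of_bool (q = p) + of_bool (q = (n - fst p, n - snd p))"
    if "p \<in> orbit_reps n" "q \<in> orbit_reps n" for p q
  proof -
    obtain i j k l where pq: "p = (i, j)" "q = (k, l)" by (cases p; cases q)
    have "\<phi> q (D p) = (\<Sum>a=1..k. \<Sum>b=1..l. block n i j a b)"
      unfolding \<phi>_def D_def pq prod.case
      using that by (intro sum.cong refl mat_of_nth[OF e]) (auto simp: pq orbit_reps_def)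
    also have "\<dots> = of_bool (q = p) + of_bool (q = (n - fst p, n - snd p))"
      using that unfolding pq fst_conv snd_conv
      by (intro corner_sum_block) (auto simp: orbit_reps_def)
    finally show ?thesis .
  qed
  have \<phi>_same: "\<phi> p (D p) \<noteq> 0" if "p \<in> orbit_reps n" for p
    using \<phi>[OF that that] by simp
  have \<phi>_other: "\<phi> q (D p) = 0" if "p \<in> orbit_reps n" "q \<in> orbit_reps n" "p \<noteq> q" for p q
  proof -
    have "q \<noteq> (n - fst p, n - snd p)"
      using that by (cases p; cases q) (auto simp: orbit_reps_def)
    then show ?thesis using \<phi>[OF that(1,2)] that(3) by simp
  qed
  show "inj_on D (orbit_reps n)"
    using \<phi>_same \<phi>_other by (metis inj_onI)
  show "independent (D ` orbit_reps n)"
    unfolding dependent_def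
  proof (intro notI, elim bexE)
    fix x assume "x \<in> D ` orbit_reps n" and sp: "x \<in> span (D ` orbit_reps n - {x})"
    then obtain q where q: "q \<in> orbit_reps n" "x = D q" by blast
    \<comment> \<open>The functional at \<open>q\<close> kills every other block, hence their span,
      but not the block at \<open>q\<close>.\<close>
    have "\<phi> q x = 0"
      by (rule linear_eq_0_on_span[OF lin _ sp]) (use q \<phi>_other in blast)
    then show False using q \<phi>_same by simp
  qed
qed

section \<open>The dimension of the polytope\<close>

theorem theorem5p4:
  fixes n :: nat and e :: "nat \<Rightarrow> 'n::finite"
  assumes "n \<ge> 1"
    and "bij_betw e {1..n} (UNIV :: 'n set)"
  shows "aff_dim (P_HTSASM n e) = \<lceil>(real n - 1)\<^sup>2 / 2\<rceil>"
proof -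
  define S where "S = {X :: real ^ 'n ^ 'n. is_HTSASM n (\<lambda>i j. X $ e i $ e j)}"
  define B where "B = (\<lambda>(i, j). mat_of n e (block n i j)) ` orbit_reps n"
  \<comment> \<open>The antidiagonal permutation matrix serves as origin, which turns affine
    dimension into linear dimension.\<close>
  define X0 where "X0 = mat_of n e (corner_diff (corner_min n))"
  have X0: "X0 \<in> S"
    unfolding S_def X0_def using HTSASM_mat_of_corner_diff[OF assms(2) ht_corner_min] by simp
  have "span ((\<lambda>X. X - X0) ` S) = span B"
    unfolding span_eq
  proof
    show "(\<lambda>X. X - X0) ` S \<subseteq> span B"
      unfolding B_def using X0 HTSASM_difference_in_span[OF assms(2)] by (auto simp: S_def)
    show "B \<subseteq> span ((\<lambda>X. X - X0) ` S)"
      unfolding B_def S_def using block_in_span_differences[OF assms(2)]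
      by (auto simp: orbit_reps_def)
  qed
  then have "dim ((\<lambda>X. X - X0) ` S) = card B"
    using independent_blocks(1)[OF assms(2), folded B_def] by (metis dim_span dim_eq_card_independent)
  also have "card B = card (orbit_reps n)"
    unfolding B_def by (rule card_image[OF independent_blocks(2)[OF assms(2)]])
  finally have "aff_dim S = int (card (orbit_reps n))"
    using aff_dim_eq_dim_subtract[OF hull_inc[OF X0]] by simp
  \<comment> \<open>A convex hull has the affine dimension of its generating set.\<close>
  then show ?thesis
    unfolding P_HTSASM_def S_def[symmetric] aff_dim_convex_hull ceiling_half_square[OF assms(1)] .
qed

end
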